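(* Let $D=(V,A)$ be a minimal strong digraph and let $u,w\in V$ be vertices with $uw\notin A$ (here $u\neq w$, since digraphs have no loops). Let $v\notin V$ and let $e_{uw}(D)=(V\cup\{v\},\,A\cup\{uv,vw\})$ be the external expansion of $D$ by $v$ from $u$ to $w$. Then $e_{uw}(D)$ is a minimal strong digraph if and only if the digraph $D+uw=(V,A\cup\{uw\})$ has no transitive arcs other than $uw$.
   Context: A digraph is a pair $D=(V,A)$ with $V$ a finite nonempty set and $A\subseteq V\times V\setminus\{(x,x):x\in V\}$; the arc $(x,y)$ is written $xy$. $D+xy$ denotes $(V,A\cup\{xy\})$ and $D-xy$ denotes $(V,A\setminus\{xy\})$. A digraph is strong (strongly connected) if for every ordered pair of vertices $x,y$ there is a directed path from $x$ to $y$. A strong digraph $D$ is minimal strong if $D-a$ is not strong for every arc $a\in A$. An arc $xy$ of a digraph is transitive if there is a directed $x$–$y$ path in the digraph other than the arc $xy$ itself. *)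

theory Defs
  imports "Graph_Theory.Graph_Theory"
begin

text \<open>
  Digraphs are finite, loop-free and have pairs of vertices as arcs, so they are the
  \<^typ>\<open>'a pair_pre_digraph\<close>s satisfying \<^const>\<open>pair_digraph\<close>. That locale admits the null
  graph; \<^const>\<open>strongly_connected\<close> excludes it.
\<close>

definition add_parc :: "'a pair_pre_digraph \<Rightarrow> 'a \<times> 'a \<Rightarrow> 'a pair_pre_digraph" where
  "add_parc D a = \<lparr> pverts = pverts D, parcs = parcs D \<union> {a} \<rparr>"

definition del_parc :: "'a pair_pre_digraph \<Rightarrow> 'a \<times> 'a \<Rightarrow> 'a pair_pre_digraph" where
  "del_parc D a = \<lparr> pverts = pverts D, parcs = parcs D - {a} \<rparr>"

definition minimal_strong :: "'a pair_pre_digraph \<Rightarrow> bool" where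
  "minimal_strong D \<longleftrightarrow>
     pair_digraph D \<and> strongly_connected (with_proj D) \<and>
     (\<forall>a \<in> parcs D. \<not> strongly_connected (with_proj (del_parc D a)))"

definition transitive_arc :: "'a pair_pre_digraph \<Rightarrow> 'a \<times> 'a \<Rightarrow> bool" where
  "transitive_arc D a \<longleftrightarrow>
     a \<in> parcs D \<and> (\<exists>p. pre_digraph.apath (with_proj D) (fst a) p (snd a) \<and> p \<noteq> [a])"

definition external_expansion ::
  "'a pair_pre_digraph \<Rightarrow> 'a \<Rightarrow> 'a \<Rightarrow> 'a \<Rightarrow> 'a pair_pre_digraph" where
  "external_expansion D u w v =
     \<lparr> pverts = pverts D \<union> {v}, parcs = parcs D \<union> {(u, v), (v, w)} \<rparr>"

end

theory Submission
  imports Defs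
begin

text \<open>
  A strong digraph is minimal strong iff it has no transitive arcs, and an arc \<open>a = xy\<close> is transitive
  iff \<open>y\<close> is still reachable from \<open>x\<close> after deleting \<open>a\<close>. In the expansion, \<open>uv\<close> is the only arc
  entering \<open>v\<close> and \<open>vw\<close> the only arc leaving it, so neither is transitive. Between vertices
  of \<open>D\<close> the detour \<open>u, v, w\<close> and the arc \<open>uw\<close> give the same reachability, so an arc of \<open>D\<close> is
  transitive in the expansion iff it is transitive in \<open>D + uw\<close>.
\<close>

lemma reachable_with_proj_iff_rtrancl:
  assumes "pair_wf_digraph G" and "x \<in> pverts G"
  shows "x \<rightarrow>\<^sup>*\<^bsub>with_proj G\<^esub> y \<longleftrightarrow> (x, y) \<in> (parcs G)\<^sup>*"
proof
  assume "x \<rightarrow>\<^sup>*\<^bsub>with_proj G\<^esub> y"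
  then show "(x, y) \<in> (parcs G)\<^sup>*"
    by (auto simp: reachable_def dest: rtrancl_on_rtranclI)
next
  assume "(x, y) \<in> (parcs G)\<^sup>*"
  then show "x \<rightarrow>\<^sup>*\<^bsub>with_proj G\<^esub> y"
    using assms(2)
    by induction (auto simp: reachable_def intro: rtrancl_on_into_rtrancl_on
        pair_wf_digraph.in_arcsD2[OF assms(1)])
qed

lemma strongly_connected_with_proj_iff:
  assumes "pair_wf_digraph G"
  shows "strongly_connected (with_proj G) \<longleftrightarrow>
    pverts G \<noteq> {} \<and> (\<forall>x\<in>pverts G. \<forall>y\<in>pverts G. (x, y) \<in> (parcs G)\<^sup>*)"
  by (auto simp: strongly_connected_def reachable_with_proj_iff_rtrancl[OF assms])

lemma pair_wf_digraph_del_parc: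
  "pair_wf_digraph G \<Longrightarrow> pair_wf_digraph (del_parc G a)"
  by (auto simp: pair_wf_digraph_def del_parc_def)

lemma apath_del_parc_imp_apath:
  "pre_digraph.apath (with_proj (del_parc G a)) x p y \<Longrightarrow>
    pre_digraph.apath (with_proj G) x p y \<and> a \<notin> set p"
  by (auto simp: pre_digraph.apath_def pre_digraph.awalk_def cas_with_proj_eq
      awalk_verts_with_proj_eq del_parc_def)

text \<open>An \<open>apath\<close> repeats no vertex, so a path from \<open>x\<close> to
  \<open>y\<close> that uses \<open>(x, y)\<close> can only be that single arc; every other path
  survives its deletion. Conversely, a walk that avoids the arc shortens to a path that avoids
  it.\<close>

lemma transitive_arc_iff_rtrancl:
  assumes "pair_wf_digraph G"
  shows "transitive_arc G (x, y) \<longleftrightarrow>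
    (x, y) \<in> parcs G \<and> (x, y) \<in> (parcs G - {(x, y)})\<^sup>*"
proof (intro iffI conjI; (elim conjE)?)
  interpret pair_wf_digraph G by fact
  assume "transitive_arc G (x, y)"
  then obtain p where p: "apath x p y" "p \<noteq> [(x, y)]" and "(x, y) \<in> parcs G"
    by (auto simp: transitive_arc_def)
  then show "(x, y) \<in> parcs G" by simp
  show "(x, y) \<in> (parcs G - {(x, y)})\<^sup>*"
  proof -
    \<comment> \<open>A path that misses \<open>x\<close> uses no arc leaving \<open>x\<close>, in
      particular not \<open>(x, y)\<close>.\<close>
    have avoid: "(z, y) \<in> (parcs G - {(x, y)})\<^sup>*"
      if "apath z q y" "x \<notin> set (pawalk_verts z q)" for z q
      using that
    proof (induction q arbitrary: z)
      case (Cons e q)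
      then show ?case
        by (cases e) (auto simp: apath_Cons_iff intro: converse_rtrancl_into_rtrancl)
    qed (simp add: apath_Nil_iff)
    show ?thesis
    proof (cases p)
      case (Cons e q)
      then obtain z where e: "e = (x, z)" "(x, z) \<in> parcs G" and q: "apath z q y"
        and x: "x \<notin> set (pawalk_verts z q)"
        using p by (cases e) (auto simp: apath_Cons_iff)
      \<comment> \<open>Otherwise \<open>q\<close> would be a path from \<open>y\<close> to itself,
        hence empty, and \<open>p\<close> would be the arc alone.\<close>
      have "z \<noteq> y"
        using apath_nonempty_ends[OF q] p(2) Cons e(1) by auto
      with e avoid[OF q x] show ?thesis
        by (auto intro: converse_rtrancl_into_rtrancl)
    qed (use p in \<open>simp add: apath_Nil_iff\<close>)
  qed
next
  let ?H = "del_parc G (x, y)"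
  interpret H: pair_wf_digraph ?H
    using assms by (rule pair_wf_digraph_del_parc)
  assume xy: "(x, y) \<in> parcs G" and reach: "(x, y) \<in> (parcs G - {(x, y)})\<^sup>*"
  have "x \<in> pverts ?H"
    using xy pair_wf_digraph.arc_fst_in_verts[OF assms] by (fastforce simp: del_parc_def)
  with reach have "x \<rightarrow>\<^sup>*\<^bsub>with_proj ?H\<^esub> y"
    by (subst reachable_with_proj_iff_rtrancl[OF H.pair_wf_digraph_axioms])
      (simp_all add: del_parc_def)
  then obtain p where "H.apath x p y"
    using H.reachable_awalk H.apath_awalk_to_apath by blast
  then have "pre_digraph.apath (with_proj G) x p y" "p \<noteq> [(x, y)]"
    by (auto dest: apath_del_parc_imp_apath)
  with xy show "transitive_arc G (x, y)"
    by (auto simp: transitive_arc_def)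
qed

lemma strongly_connected_del_parc_iff_transitive_arc:
  assumes wf: "pair_wf_digraph G" and strong: "strongly_connected (with_proj G)"
    and arc: "a \<in> parcs G"
  shows "strongly_connected (with_proj (del_parc G a)) \<longleftrightarrow> transitive_arc G a"
proof -
  obtain x y where a: "a = (x, y)" by (cases a)
  have xy: "x \<in> pverts G" "y \<in> pverts G"
    using wf arc a by (auto simp: pair_wf_digraph_def)
  have del: "pverts (del_parc G a) = pverts G" "parcs (del_parc G a) = parcs G - {a}"
    by (simp_all add: del_parc_def)
  \<comment> \<open>Each use of \<open>a\<close> in a walk is replaced by a detour avoiding
    \<open>a\<close>.\<close>
  have "(parcs G)\<^sup>* \<subseteq> (parcs G - {a})\<^sup>*" if "a \<in> (parcs G - {a})\<^sup>*"
    using that by (intro rtrancl_subset_rtrancl) auto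
  then show ?thesis
    using strong arc xy
    unfolding a transitive_arc_iff_rtrancl[OF wf] strongly_connected_with_proj_iff[OF wf]
      strongly_connected_with_proj_iff[OF pair_wf_digraph_del_parc[OF wf]] del[unfolded a]
    by blast
qed

lemma minimal_strong_iff_no_transitive_arc:
  "minimal_strong G \<longleftrightarrow>
    pair_digraph G \<and> strongly_connected (with_proj G) \<and> (\<forall>a. \<not> transitive_arc G a)"
proof -
  have "pair_wf_digraph G" if "pair_digraph G"
    using that by (simp add: pair_digraph_def pair_fin_digraph_def)
  then show ?thesis
    unfolding minimal_strong_def
    using strongly_connected_del_parc_iff_transitive_arc[of G]
    by (metis transitive_arc_def)
qed

text \<open>As \<open>B\<close> does not touch \<open>v\<close>, a walk between other vertices can
  pass through \<open>v\<close> only along \<open>u\<close>, \<open>v\<close>, \<open>w\<close>, and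
  this passage is interchangeable with the arc \<open>(u, w)\<close>.\<close>

lemma rtrancl_subdivide_iff:
  assumes "B \<subseteq> V \<times> V" "v \<notin> V" "u \<noteq> v" "x \<noteq> v" "y \<noteq> v"
  shows "(x, y) \<in> (B \<union> {(u, v), (v, w)})\<^sup>* \<longleftrightarrow> (x, y) \<in> (insert (u, w) B)\<^sup>*"
proof
  assume "(x, y) \<in> (B \<union> {(u, v), (v, w)})\<^sup>*"
  \<comment> \<open>The induction also meets walks that end at \<open>v\<close>. These are pulled
    back to \<open>u\<close>, so that entering \<open>v\<close> costs nothing and leaving it is
    matched by \<open>(u, w)\<close>.\<close>
  then have "(x, if y = v then u else y) \<in> (insert (u, w) B)\<^sup>*"
  proof (induction rule: rtrancl_induct)
    case (step z z')
    have "z = z'' \<Longrightarrow> (z'', z') \<in> B \<Longrightarrow> z \<noteq> v \<and> z' \<noteq> v" for z''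
      using assms by auto
    with step assms(3) show ?case
      by (auto split: if_splits intro: rtrancl_into_rtrancl)
  qed (use assms in simp)
  with assms show "(x, y) \<in> (insert (u, w) B)\<^sup>*" by simp
next
  have "insert (u, w) B \<subseteq> (B \<union> {(u, v), (v, w)})\<^sup>*"
    by (auto intro: converse_rtrancl_into_rtrancl)
  then show "(x, y) \<in> (insert (u, w) B)\<^sup>* \<Longrightarrow> (x, y) \<in> (B \<union> {(u, v), (v, w)})\<^sup>*"
    using rtrancl_subset_rtrancl by blast
qed

theorem theorem3p3:
  fixes D :: "'a pair_pre_digraph" and u w v :: 'a
  assumes "minimal_strong D"
    and "u \<in> pverts D" and "w \<in> pverts D" and "u \<noteq> w"
    and "(u, w) \<notin> parcs D"
    and "v \<notin> pverts D"
  shows "minimal_strong (external_expansion D u w v) \<longleftrightarrow>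
    \<not> (\<exists>a. transitive_arc (add_parc D (u, w)) a \<and> a \<noteq> (u, w))"
proof -
  let ?E = "external_expansion D u w v" and ?P = "add_parc D (u, w)"
  have dig: "pair_digraph D" and strong: "strongly_connected (with_proj D)"
    using assms(1) by (auto simp: minimal_strong_def)
  interpret pair_digraph D by fact
  have AV: "parcs D \<subseteq> pverts D \<times> pverts D"
    using arc_fst_in_verts arc_snd_in_verts by fastforce
  have uv: "u \<noteq> v" and wv: "w \<noteq> v" using assms by auto
  have E: "pverts ?E = insert v (pverts D)" "parcs ?E = parcs D \<union> {(u, v), (v, w)}"
    by (auto simp: external_expansion_def)
  have P: "pverts ?P = pverts D" "parcs ?P = insert (u, w) (parcs D)"
    by (auto simp: add_parc_def)
  have wfP: "pair_wf_digraph ?P"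
    using AV assms unfolding pair_wf_digraph_def P by auto
  have digE: "pair_digraph ?E"
    using AV assms uv wv pair_finite_verts pair_finite_arcs pair_no_loops
    by unfold_locales (auto simp: E)
  then have wfE: "pair_wf_digraph ?E"
    by (simp add: pair_digraph_def pair_fin_digraph_def)
  have "(x, y) \<in> (parcs ?E)\<^sup>*" if xy: "x \<in> pverts ?E" "y \<in> pverts ?E" for x y
  proof -
    have D: "(s, t) \<in> (parcs ?E)\<^sup>*" if "s \<in> pverts D" "t \<in> pverts D" for s t
      using strong that strongly_connected_with_proj_iff[OF pair_wf_digraph_axioms]
        rtrancl_mono[of "parcs D" "parcs ?E"] by (auto simp: E(2))
    \<comment> \<open>A walk from \<open>v\<close> starts with \<open>(v, w)\<close>, a walk to
      \<open>v\<close> ends with \<open>(u, v)\<close>, and strength of \<open>D\<close> supplies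
      the rest.\<close>
    have "(x, w) \<in> (parcs ?E)\<^sup>*" if "x = v" using that by (auto simp: E(2))
    moreover have "(u, y) \<in> (parcs ?E)\<^sup>*" if "y = v" using that by (auto simp: E(2))
    ultimately show ?thesis
      using xy D assms(2,3) unfolding E(1) by (metis insertE rtrancl_trans)
  qed
  then have strongE: "strongly_connected (with_proj ?E)"
    by (simp add: strongly_connected_with_proj_iff[OF wfE] E(1))
  have uvE: "\<not> transitive_arc ?E (u, v)"
  proof
    assume "transitive_arc ?E (u, v)"
    then have "(u, v) \<in> (parcs ?E - {(u, v)})\<^sup>*"
      by (simp add: transitive_arc_iff_rtrancl[OF wfE])
    then show False
      \<comment> \<open>The last arc of such a walk would have to enter \<open>v\<close>, but the
        only arc doing so is deleted.\<close>
      using uv wv AV assms(6) by (cases rule: rtranclE) (auto simp: E(2))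
  qed
  have vwE: "\<not> transitive_arc ?E (v, w)"
  proof
    assume "transitive_arc ?E (v, w)"
    then have "(v, w) \<in> (parcs ?E - {(v, w)})\<^sup>*"
      by (simp add: transitive_arc_iff_rtrancl[OF wfE])
    then show False
      \<comment> \<open>Dually, no arc is left for the first step out of \<open>v\<close>.\<close>
      using uv wv AV assms(6) by (cases rule: converse_rtranclE) (auto simp: E(2))
  qed
  have DE: "transitive_arc ?E (x, y) \<longleftrightarrow> transitive_arc ?P (x, y)"
    if xy: "(x, y) \<in> parcs D" for x y
  proof -
    \<comment> \<open>An arc of \<open>D\<close> differs from \<open>(u, w)\<close> and from both
      arcs at \<open>v\<close>, so deleting it leaves these in place and the subdivision lemma
      applies with \<open>B\<close> as \<open>parcs D - {(x, y)}\<close>.\<close>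
    have ne: "x \<noteq> v" "y \<noteq> v" "(x, y) \<noteq> (u, w)" using xy AV assms by auto
    then have "parcs ?E - {(x, y)} = (parcs D - {(x, y)}) \<union> {(u, v), (v, w)}"
      "parcs ?P - {(x, y)} = insert (u, w) (parcs D - {(x, y)})"
      by (auto simp: E(2) P(2))
    moreover have "(x, y) \<in> ((parcs D - {(x, y)}) \<union> {(u, v), (v, w)})\<^sup>* \<longleftrightarrow>
        (x, y) \<in> (insert (u, w) (parcs D - {(x, y)}))\<^sup>*"
      using AV assms(6) uv ne by (intro rtrancl_subdivide_iff[where V = "pverts D"]) auto
    ultimately show ?thesis
      using xy
      by (simp add: transitive_arc_iff_rtrancl[OF wfE] transitive_arc_iff_rtrancl[OF wfP] E(2) P(2))
  qed
  have inE: "a \<in> parcs D \<union> {(u, v), (v, w)}" if "transitive_arc ?E a" for a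
    using that by (simp add: transitive_arc_def E(2))
  have inP: "a \<in> insert (u, w) (parcs D)" if "transitive_arc ?P a" for a
    using that by (simp add: transitive_arc_def P(2))
  have "(\<exists>a. transitive_arc ?E a) \<longleftrightarrow> (\<exists>a. transitive_arc ?P a \<and> a \<noteq> (u, w))"
  proof
    assume "\<exists>a. transitive_arc ?E a"
    then obtain x y where t: "transitive_arc ?E (x, y)" by auto
    with inE uvE vwE have "(x, y) \<in> parcs D" by blast
    with t DE assms(5) show "\<exists>a. transitive_arc ?P a \<and> a \<noteq> (u, w)" by metis
  next
    assume "\<exists>a. transitive_arc ?P a \<and> a \<noteq> (u, w)"
    then obtain x y where "transitive_arc ?P (x, y)" "(x, y) \<noteq> (u, w)" by auto
    with inP DE show "\<exists>a. transitive_arc ?E a" by blast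
  qed
  then show ?thesis
    using digE strongE unfolding minimal_strong_iff_no_transitive_arc by blast
qed

end
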